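(* Let $w$ be a woman in a stable matching instance. Suppose $w$ has popularity preferences defined by $\mathcal D_w$ over her set of $d_w$ acceptable men. The preference lists of all men and of all women other than $w$ are arbitrary (fixed), as are the acceptable sets. Assume $w$ has at least one stable partner. Then \[\mathbb E[\text{number of stable husbands of } w]\le 1+\ln d_w+\mathbb E\left[\ln\frac{\mathcal D_w(\mu_{\mathcal W}(w))}{\mathcal D_w(\mu_{\mathcal M}(w))}\right],\] where $\mu_{\mathcal M}(w)$ is $w$'s least preferred stable partner and $\mu_{\mathcal W}(w)$ is her most preferred stable partner.
   Context: Popularity preferences: $w$ assigns a positive popularity $\mathcal D_w(m)$ to each acceptable man $m$, with these values summing to $1$. She draws her favourite man from $\mathcal D_w$, then her second favourite from the remaining acceptable men with probability proportional to $\mathcal D_w$, and so on until all acceptable men are ranked. Stability: a pair $(m,w')$ blocks a matching if each prefers the other to his/her current partner (being single counts as partner oneself, ranked right after the acceptable partners). A person matched to an unacceptable partner also blocks. A matching is stable if nothing blocks it. A stable husband of $w$ is a man matched to $w$ in some stable matching. Each person who is matched in some stable matching is matched in all of them. *)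

theory Defs
  imports "HOL-Probability.Probability"
begin

text \<open>
  A preference list contains exactly the acceptable partners, best first. A partner is an
  option value, None meaning that the person is single. Being single is ranked right after the
  acceptable partners and before all unacceptable ones. The latter are tied, which does not
  affect stability, since nobody is matched to an unacceptable partner in a stable matching.
\<close>

definition pref_rank :: "'a list \<Rightarrow> 'a option \<Rightarrow> nat" where
  "pref_rank xs p = length (takeWhile (\<lambda>q. q \<noteq> p) (map Some xs @ [None]))"

definition prefers :: "'a list \<Rightarrow> 'a option \<Rightarrow> 'a option \<Rightarrow> bool" where
  "prefers xs p q \<longleftrightarrow> pref_rank xs p < pref_rank xs q"

definition preference_list :: "'a set \<Rightarrow> 'a list \<Rightarrow> bool" where
  "preference_list S xs \<longleftrightarrow> distinct xs \<and> set xs \<subseteq> S"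

definition matching ::
  "'m set \<Rightarrow> 'w set \<Rightarrow> ('m \<Rightarrow> 'w option) \<Rightarrow> ('w \<Rightarrow> 'm option) \<Rightarrow> bool" where
  "matching M W wife husband \<longleftrightarrow>
     (\<forall>m w. wife m = Some w \<longleftrightarrow> husband w = Some m) \<and>
     (\<forall>m w. wife m = Some w \<longrightarrow> m \<in> M \<and> w \<in> W)"

text \<open>Acceptability need not be mutual.\<close>

definition stable_matching ::
  "'m set \<Rightarrow> 'w set \<Rightarrow> ('m \<Rightarrow> 'w list) \<Rightarrow> ('w \<Rightarrow> 'm list) \<Rightarrow>
   ('m \<Rightarrow> 'w option) \<Rightarrow> ('w \<Rightarrow> 'm option) \<Rightarrow> bool" where
  "stable_matching M W pm pw wife husband \<longleftrightarrow>
     matching M W wife husband \<and>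
     (\<forall>m\<in>M. \<forall>w. wife m = Some w \<longrightarrow> w \<in> set (pm m)) \<and>
     (\<forall>w\<in>W. \<forall>m. husband w = Some m \<longrightarrow> m \<in> set (pw w)) \<and>
     \<not> (\<exists>m\<in>M. \<exists>w\<in>W. prefers (pm m) (Some w) (wife m) \<and> prefers (pw w) (Some m) (husband w))"

definition stable_husbands ::
  "'m set \<Rightarrow> 'w set \<Rightarrow> ('m \<Rightarrow> 'w list) \<Rightarrow> ('w \<Rightarrow> 'm list) \<Rightarrow> 'w \<Rightarrow> 'm set" where
  "stable_husbands M W pm pw w =
     {m. \<exists>wife husband. stable_matching M W pm pw wife husband \<and> husband w = Some m}"

definition most_preferred :: "'a list \<Rightarrow> 'a set \<Rightarrow> 'a" where
  "most_preferred xs S =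
     (THE m. m \<in> S \<and> (\<forall>m'\<in>S. m' \<noteq> m \<longrightarrow> prefers xs (Some m) (Some m')))"

definition least_preferred :: "'a list \<Rightarrow> 'a set \<Rightarrow> 'a" where
  "least_preferred xs S =
     (THE m. m \<in> S \<and> (\<forall>m'\<in>S. m' \<noteq> m \<longrightarrow> prefers xs (Some m') (Some m)))"

text \<open>
  Successive draws without replacement: conditioning \<open>D\<close> on the set \<open>R\<close> of remaining men is
  drawing from \<open>R\<close> with probability proportional to \<open>D\<close>. The number of draws never exceeds the
  size of \<open>R\<close> below, so \<open>cond_pmf\<close> is never applied to a null set.
\<close>

primrec draw_without_replacement :: "'a pmf \<Rightarrow> nat \<Rightarrow> 'a set \<Rightarrow> 'a list pmf" where
  "draw_without_replacement D 0 R = return_pmf []"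
| "draw_without_replacement D (Suc n) R =
     bind_pmf (cond_pmf D R) (\<lambda>m. map_pmf ((#) m) (draw_without_replacement D n (R - {m})))"

text \<open>The acceptable men are those of positive popularity, i.e. the (finite) support of \<open>D\<close>.\<close>

definition popularity_preferences :: "'a pmf \<Rightarrow> 'a list pmf" where
  "popularity_preferences D = draw_without_replacement D (card (set_pmf D)) (set_pmf D)"

end

theory Submission
  imports Defs
begin

text \<open>
  Run men-proposing deferred acceptance with \<open>w\<close> rejecting everybody, resp. accepting only \<open>m\<close>, and
  let \<open>K\<close>, resp. \<open>\<kappa> m\<close>, be the set of acceptable men who propose to \<open>w\<close>. These sets do not depend on
  the list of \<open>w\<close>; \<open>m\<close> is a stable husband iff \<open>m\<close> is the favourite of \<open>w\<close> in \<open>\<kappa> m\<close>, and \<open>m' \<notin> \<kappa> m\<close>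
  implies \<open>\<kappa> m \<subseteq> \<kappa> m'\<close>. That \<open>m\<close> is the worst stable husband is an event about the order on \<open>\<kappa> m\<close>.
  By Luce's axiom, given this event each \<open>y \<in> K - \<kappa> m\<close> is a stable husband with probability
  \<open>D y / D (\<kappa> y)\<close>, and as \<open>D y / S \<le> ln (S / (S - D y))\<close> these probabilities telescope to at most
  \<open>ln (D K / D (\<kappa> m)) \<le> ln (D K / D m)\<close>. Finally the best stable husband is the favourite of \<open>w\<close> in
  \<open>K\<close>, so if \<open>\<mu>\<close> denotes him, the expectation of \<open>ln (D K / D \<mu>)\<close> is an entropy, at most \<open>ln (card K)\<close>.
\<close>

section \<open>Ranks in a preference list and the strict order they induce\<close>

lemma pref_rank_Nil_Some [simp]: "pref_rank [] (Some x) = 1"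
  and pref_rank_Cons_Some [simp]:
    "pref_rank (x # xs) (Some y) = (if x = y then 0 else Suc (pref_rank xs (Some y)))"
  and pref_rank_None [simp]: "pref_rank xs None = length xs"
  by (induction xs) (auto simp: pref_rank_def)

lemma pref_rank_less_length_iff: "pref_rank xs (Some x) < length xs \<longleftrightarrow> x \<in> set xs"
  by (induction xs) auto

text \<open>\<open>takeWhile\<close> then runs past the final \<open>None\<close>, so all
  unacceptable partners tie one place after being single, whose rank is
  \<open>length xs\<close>.\<close>

lemma pref_rank_notin: "x \<notin> set xs \<Longrightarrow> pref_rank xs (Some x) = Suc (length xs)"
  by (induction xs) auto

lemma pref_rank_le: "pref_rank xs (Some x) \<le> Suc (length xs)"
  by (induction xs) auto

lemma pref_rank_inj: "x \<in> set xs \<Longrightarrow> pref_rank xs (Some x) = pref_rank xs (Some y) \<Longrightarrow> x = y"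
  by (induction xs) (auto split: if_splits)

lemma prefers_None_iff [simp]: "prefers xs (Some x) None \<longleftrightarrow> x \<in> set xs"
  by (simp add: prefers_def pref_rank_less_length_iff)

lemma prefers_imp_in_set: "prefers xs (Some x) p \<Longrightarrow> x \<in> set xs"
  using pref_rank_less_length_iff[of xs x] pref_rank_notin[of x xs] pref_rank_le[of xs "the p"]
  by (cases p) (auto simp: prefers_def not_less intro: ccontr)

lemma prefers_linear:
  assumes "x \<in> set xs" "p \<noteq> Some x"
  shows "prefers xs (Some x) p \<or> prefers xs p (Some x)"
proof (cases p)
  case None
  with assms show ?thesis by simp
next
  case (Some y)
  with assms show ?thesis using pref_rank_inj[of x xs y] by (fastforce simp: prefers_def)
qed

lemma prefers_irrefl [simp]: "\<not> prefers xs p p"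
  by (simp add: prefers_def)

lemma prefers_asym: "prefers xs p q \<Longrightarrow> \<not> prefers xs q p"
  by (simp add: prefers_def)

lemma prefers_Cons:
  "prefers (x # xs) (Some y) (Some z) \<longleftrightarrow>
     x = y \<and> y \<noteq> z \<or> x \<noteq> y \<and> x \<noteq> z \<and> prefers xs (Some y) (Some z)"
  by (auto simp: prefers_def)

lemma prefers_split_iff:
  assumes "xs = us @ u # vs" "distinct xs"
  shows "prefers xs (Some v) (Some u) \<longleftrightarrow> v \<in> set us"
  using assms by (induction us arbitrary: xs) (auto simp: prefers_Cons)

subsection \<open>Deferred acceptance\<close>

text \<open>The proposals ever made and the rejections ever issued in men-proposing deferred acceptance,
  as a least fixed point, hence without fixing a schedule.\<close>

inductive proposes and rejected for M :: "'m set" and pm :: "'m \<Rightarrow> 'w list" and pw :: "'w \<Rightarrow> 'm list"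
  where
  proposes: "m \<in> M \<Longrightarrow> pm m = us @ w # vs \<Longrightarrow> (\<And>u. u \<in> set us \<Longrightarrow> rejected M pm pw m u)
    \<Longrightarrow> proposes M pm pw m w"
| unacceptable: "proposes M pm pw m w \<Longrightarrow> m \<notin> set (pw w) \<Longrightarrow> rejected M pm pw m w"
| outbid: "proposes M pm pw m w \<Longrightarrow> proposes M pm pw m' w \<Longrightarrow> prefers (pw w) (Some m') (Some m)
    \<Longrightarrow> rejected M pm pw m w"

lemma rejected_imp_proposes: "rejected M pm pw m u \<Longrightarrow> proposes M pm pw m u"
  by (erule rejected.cases) auto

text \<open>Only the list of \<open>w\<close> differs, so every rule at another woman carries over.
  Rejections by \<open>w\<close> are left to \<open>upd\<close>, which may presuppose the proposal
  under \<open>ys\<close> because the induction supplies it.\<close>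

lemma proposes_rejected_mono:
  assumes upd: "\<And>m. rejected M pm (pw(w := xs)) m w \<Longrightarrow> proposes M pm (pw(w := ys)) m w
     \<Longrightarrow> rejected M pm (pw(w := ys)) m w"
  shows "proposes M pm (pw(w := xs)) m u \<Longrightarrow> proposes M pm (pw(w := ys)) m u"
    and "rejected M pm (pw(w := xs)) m u \<Longrightarrow> rejected M pm (pw(w := ys)) m u"
proof (induction rule: proposes_rejected.inducts)
  case (proposes m us u vs)
  then show ?case by (intro proposes_rejected.proposes) auto
next
  case (unacceptable m u)
  show ?case
  proof (cases "u = w")
    case True
    then show ?thesis
      using upd proposes_rejected.unacceptable[OF unacceptable(1,3)] unacceptable(2) by blast
  qed (use unacceptable in \<open>auto intro: proposes_rejected.unacceptable\<close>)
next
  case (outbid m u m')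
  show ?case
  proof (cases "u = w")
    case True
    then show ?thesis
      using upd proposes_rejected.outbid[OF outbid(1,3,5)] outbid(2) by blast
  qed (use outbid in \<open>auto intro: proposes_rejected.outbid\<close>)
qed

text \<open>\<open>S\<close> may contain unacceptable elements, all tied last; a minimiser of the
  rank does at least as well as the acceptable \<open>x\<close>, hence is acceptable and alone at
  its rank.\<close>

lemma finite_rank_minimal:
  assumes "finite S" "x \<in> S" "x \<in> set xs"
  obtains y where "y \<in> S" "y \<in> set xs" "y = x \<or> prefers xs (Some y) (Some x)"
    "\<And>z. z \<in> S \<Longrightarrow> z \<noteq> y \<Longrightarrow> prefers xs (Some y) (Some z)"
proof -
  obtain y where y: "y \<in> S" "\<And>z. z \<in> S \<Longrightarrow> pref_rank xs (Some y) \<le> pref_rank xs (Some z)"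
    using arg_min_if_finite(1)[OF assms(1), of "\<lambda>x. pref_rank xs (Some x)"]
      arg_min_least[OF assms(1), of _ "\<lambda>x. pref_rank xs (Some x)"] assms(2) by blast
  have "y \<in> set xs"
    using y(2)[OF assms(2)] assms(3) pref_rank_less_length_iff by (metis order_le_less_trans)
  then show thesis
    using y assms pref_rank_inj[of y xs] that[of y]
    by (metis order_le_less prefers_def)
qed

lemma bij_betw_partners:
  assumes "\<And>m u. f m = Some u \<longleftrightarrow> g u = Some m"
  shows "bij_betw (\<lambda>m. the (f m)) {m. f m \<noteq> None} {u. g u \<noteq> None}"
proof (rule bij_betw_byWitness[where f' = "\<lambda>u. the (g u)"])
  show "\<forall>m\<in>{m. f m \<noteq> None}. the (g (the (f m))) = m"
    "(\<lambda>m. the (f m)) ` {m. f m \<noteq> None} \<subseteq> {u. g u \<noteq> None}"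
    using assms[THEN iffD1] by force+
  show "\<forall>u\<in>{u. g u \<noteq> None}. the (f (the (g u))) = u"
    "(\<lambda>u. the (g u)) ` {u. g u \<noteq> None} \<subseteq> {m. f m \<noteq> None}"
    using assms[THEN iffD2] by force+
qed

section \<open>Stable matchings compared with the outcome of deferred acceptance\<close>

locale market =
  fixes M :: "'m set" and W :: "'w set" and pm :: "'m \<Rightarrow> 'w list"
  assumes finite_M: "finite M"
    and pm: "\<And>m. m \<in> M \<Longrightarrow> preference_list W (pm m)"
begin

abbreviation "prop \<equiv> proposes M pm"
abbreviation "rej \<equiv> rejected M pm"
abbreviation "stab \<equiv> stable_matching M W pm"

lemma propD:
  assumes "prop pw m u"
  shows "m \<in> M" "u \<in> set (pm m)" "u \<in> W"
    and "prefers (pm m) (Some v) (Some u) \<Longrightarrow> rej pw m v"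
proof -
  from assms obtain us vs where *: "m \<in> M" "pm m = us @ u # vs"
      "\<And>u. u \<in> set us \<Longrightarrow> rej pw m u"
    by (cases rule: proposes.cases) auto
  show "m \<in> M" "u \<in> set (pm m)" "u \<in> W"
    using * pm[of m] by (auto simp: preference_list_def)
  show "rej pw m v" if "prefers (pm m) (Some v) (Some u)"
    using * that prefers_split_iff[OF *(2)] pm[of m] by (auto simp: preference_list_def)
qed

text \<open>Gale and Shapley's argument, by simultaneous induction: a proposer has been rejected by
  everyone he ranks higher, so his stable wife is not among them; if a stable wife rejected her
  husband for \<open>m'\<close>, she and \<open>m'\<close> would block.\<close>

lemma stable_proposes_rejected:
  assumes "stab pw wife husband"
  shows "prop pw m u \<Longrightarrow> \<not> prefers (pm m) (wife m) (Some u)"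
    and "rej pw m u \<Longrightarrow> wife m \<noteq> Some u"
proof (induction rule: proposes_rejected.inducts)
  case (proposes m us u vs)
  show ?case
  proof
    assume *: "prefers (pm m) (wife m) (Some u)"
    show False
    proof (cases "wife m")
      case None
      with * proposes(2) have "length (pm m) < pref_rank (pm m) (Some u)" "u \<in> set (pm m)"
        by (auto simp: prefers_def)
      then show False using pref_rank_less_length_iff[of "pm m" u] by simp
    next
      case (Some v)
      with * proposes(1) have "v \<in> set us"
        using prefers_split_iff[OF proposes(2)] pm[of m] by (auto simp: preference_list_def)
      with proposes Some show False by blast
    qed
  qed
next
  case (unacceptable m u)
  then show ?case using assms unfolding stable_matching_def matching_def by metis
next
  case (outbid m u m')
  have m': "m' \<in> M" "u \<in> set (pm m')" "u \<in> W" using propD[OF outbid(3)] by auto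
  show ?case
  proof
    assume wife: "wife m = Some u"
    then have h: "husband u = Some m" and "wife m' \<noteq> Some u"
      using assms outbid(5) unfolding stable_matching_def matching_def
      by (metis, metis option.sel prefers_irrefl)
    have "prefers (pm m') (Some u) (wife m')"
    using outbid(4) prefers_linear[OF m'(2), of "wife m'"] \<open>wife m' \<noteq> Some u\<close> by blast
    then show False
      using assms outbid(5) h m' unfolding stable_matching_def by metis
  qed
qed

text \<open>The outcome of the run; \<open>SOME\<close> is unambiguous by
  \<open>unrejected_unique\<close>.\<close>

definition wife_of :: "('w \<Rightarrow> 'm list) \<Rightarrow> 'm \<Rightarrow> 'w option" where
  "wife_of pw m = (if \<exists>u. prop pw m u \<and> \<not> rej pw m u
     then Some (SOME u. prop pw m u \<and> \<not> rej pw m u) else None)"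

definition husband_of :: "('w \<Rightarrow> 'm list) \<Rightarrow> 'w \<Rightarrow> 'm option" where
  "husband_of pw u = (if \<exists>m. prop pw m u \<and> \<not> rej pw m u
     then Some (SOME m. prop pw m u \<and> \<not> rej pw m u) else None)"

text \<open>Of two women he has proposed to, a man was rejected by the one he ranks higher; of two
  acceptable proposers, a woman rejects the one she ranks lower.\<close>

lemma unrejected_unique:
  assumes "prop pw m u" "\<not> rej pw m u" "prop pw m' u'" "\<not> rej pw m' u'" "m = m' \<or> u = u'"
  shows "m = m'" "u = u'"
proof -
  have "u = u'" if "m = m'"
    using assms that propD(4)[OF assms(1), of u'] propD(4)[OF assms(3), of u]
      prefers_linear[OF propD(2)[OF assms(1)], of "Some u'"] by blast
  moreover have "m = m'" if "u = u'"
  proof (rule ccontr)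
    assume "m \<noteq> m'"
    moreover have "m \<in> set (pw u)" using assms unacceptable by metis
    ultimately have "prefers (pw u) (Some m) (Some m') \<or> prefers (pw u) (Some m') (Some m)"
      by (intro prefers_linear) auto
    then show False using assms that outbid by metis
  qed
  ultimately show "m = m'" "u = u'" using assms(5) by auto
qed

lemma wife_of_iff: "wife_of pw m = Some u \<longleftrightarrow> prop pw m u \<and> \<not> rej pw m u"
  using someI_ex[of "\<lambda>u. prop pw m u \<and> \<not> rej pw m u"] unrejected_unique(2)[of pw m _ m]
  unfolding wife_of_def by (smt (verit) option.distinct(1) option.inject)

lemma husband_of_iff: "husband_of pw u = Some m \<longleftrightarrow> prop pw m u \<and> \<not> rej pw m u"
  using someI_ex[of "\<lambda>m. prop pw m u \<and> \<not> rej pw m u"] unrejected_unique(1)[of pw _ u _ u]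
  unfolding husband_of_def by (smt (verit) option.distinct(1) option.inject)

lemma prefers_wife_of_imp_rejected:
  assumes "m \<in> M" "prefers (pm m) (Some u) (wife_of pw m)"
  shows "rej pw m u"
proof (cases "wife_of pw m")
  case (Some v)
  then show ?thesis using assms(2) propD(4)[of pw m v u] by (metis wife_of_iff)
next
  case None
  \<comment> \<open>A man left single is rejected all along his list: once a prefix has rejected him
    he proposes to the next woman, and having no wife means that she rejects him too.\<close>
  have "u \<in> set us \<Longrightarrow> pm m = us @ vs \<Longrightarrow> rej pw m u" for us vs u
  proof (induction us arbitrary: u vs rule: rev_induct)
    case (snoc v us)
    have "prop pw m v"
      using snoc.IH[of _ "v # vs"] snoc.prems assms(1) by (intro proposes[of m M pm us v vs]) auto
    then have "rej pw m v" using None wife_of_iff[of pw m v] by auto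
    then show ?case using snoc.IH[of u "v # vs"] snoc.prems by auto
  qed simp
  from this[of u "pm m" "[]"] assms None show ?thesis by simp
qed

text \<open>The best acceptable proposer of a woman can never be outbid, so he is her husband, and
  any acceptable man she rejected ranks below him.\<close>

lemma rejected_imp_not_prefers:
  assumes "rej pw m u"
  shows "\<not> prefers (pw u) (Some m) (husband_of pw u)"
proof
  assume *: "prefers (pw u) (Some m) (husband_of pw u)"
  then have acc: "m \<in> set (pw u)" by (rule prefers_imp_in_set)
  from assms acc obtain m' where m': "prop pw m' u" "prefers (pw u) (Some m') (Some m)"
    by (cases rule: rejected.cases) auto
  have fin: "finite {m. prop pw m u}"
    by (rule finite_subset[OF _ finite_M]) (auto dest: propD)
  obtain y where y: "prop pw y u" "y \<in> set (pw u)" "y = m' \<or> prefers (pw u) (Some y) (Some m')"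
      "\<And>z. prop pw z u \<Longrightarrow> z \<noteq> y \<Longrightarrow> prefers (pw u) (Some y) (Some z)"
    using finite_rank_minimal[OF fin, of m' "pw u"] m' prefers_imp_in_set[OF m'(2)]
    by (metis mem_Collect_eq)
  have "\<not> rej pw y u"
    using y(2,4) by (metis rejected.cases prefers_asym prefers_irrefl)
  then have "husband_of pw u = Some y" using y by (simp add: husband_of_iff)
  with * y m' show False by (auto simp: prefers_def)
qed

text \<open>The man of a blocking pair would have been rejected by the woman, and no rejected man is
  preferred to her final husband.\<close>

lemma deferred_acceptance_stable: "stab pw (wife_of pw) (husband_of pw)"
  unfolding stable_matching_def matching_def
  using prefers_wife_of_imp_rejected rejected_imp_not_prefers unacceptable[of M pm pw]
  by (simp add: wife_of_iff husband_of_iff) (blast dest: propD)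

text \<open>Rural hospitals: men weakly prefer the men-optimal matching, so more men are matched in it,
  whereas every woman matched in it is matched in any other stable matching.\<close>

lemma stable_matched_woman:
  assumes st: "stab pw wife husband" and "husband u \<noteq> None"
  shows "husband_of pw u \<noteq> None"
proof -
  let ?A = "{m. wife m \<noteq> None}" and ?B = "{m. wife_of pw m \<noteq> None}"
  let ?U = "{u. husband u \<noteq> None}" and ?V = "{u. husband_of pw u \<noteq> None}"
  have mt: "wife m = Some u \<longleftrightarrow> husband u = Some m" "wife m = Some u \<Longrightarrow> m \<in> M"
      "wife m = Some u \<Longrightarrow> u \<in> set (pm m)" for m u
    using st unfolding stable_matching_def matching_def by blast+
  have mt': "wife_of pw m = Some u \<longleftrightarrow> husband_of pw u = Some m" for m u
    by (simp add: wife_of_iff husband_of_iff)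
  have fB: "finite ?B" by (rule finite_subset[OF _ finite_M]) (auto simp: wife_of_iff dest: propD)
  have AB: "?A \<subseteq> ?B"
  proof (intro subsetI CollectI notI)
    fix m assume "m \<in> ?A" "wife_of pw m = None"
    then obtain u where "wife m = Some u" by auto
    with \<open>wife_of pw m = None\<close> have "rej pw m u"
      using prefers_wife_of_imp_rejected[of m u pw] mt(2,3)[of m u] by simp
    then show False using stable_proposes_rejected(2)[OF st] \<open>wife m = Some u\<close> by blast
  qed
  have VU: "?V \<subseteq> ?U"
  proof (intro subsetI CollectI notI)
    fix u assume "u \<in> ?V" "husband u = None"
    then obtain m where *: "husband_of pw u = Some m" "husband u = None" by auto
    then have p: "prop pw m u" "\<not> rej pw m u" by (auto simp: husband_of_iff)
    then have acc: "m \<in> set (pw u)" using unacceptable by metis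
    have "wife m \<noteq> Some u" using mt(1) * by auto
    then have "prefers (pm m) (Some u) (wife m)"
      using stable_proposes_rejected(1)[OF st p(1)] propD(2)[OF p(1)]
        prefers_linear[of u "pm m" "wife m"] by blast
    then show False
      using st propD[OF p(1)] acc * unfolding stable_matching_def by (metis prefers_None_iff)
  qed
  have "card ?A = card ?U" "card ?B = card ?V" "finite ?U"
    using bij_betw_partners[of wife husband, OF mt(1)]
      bij_betw_partners[of "wife_of pw" "husband_of pw", OF mt'] finite_subset[OF AB fB]
    by (auto dest: bij_betw_same_card bij_betw_finite)
  then have "?V = ?U"
    using VU card_mono[OF fB AB] by (intro card_seteq) auto
  with assms show ?thesis by auto
qed

text \<open>The right-hand side consults the list \<open>xs\<close> only to compare \<open>m\<close>
  with a set of men that does not depend on \<open>xs\<close>. Rural hospitals give the forward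
  direction: under the list \<open>[m]\<close> the woman \<open>w\<close> stays matched, and only
  \<open>m\<close> can be her husband.\<close>

lemma stable_husbands_iff:
  assumes "w \<in> W" and "m \<in> set xs"
  shows "m \<in> stable_husbands M W pm (pw(w := xs)) w \<longleftrightarrow>
    prop (pw(w := [m])) m w \<and>
    (\<forall>m'\<in>set xs. prop (pw(w := [m])) m' w \<longrightarrow> m' \<noteq> m \<longrightarrow> prefers xs (Some m) (Some m'))"
    (is "_ \<longleftrightarrow> ?R")
proof
  let ?p = "pw(w := [m])"
  assume "m \<in> stable_husbands M W pm (pw(w := xs)) w"
  then obtain wife husband
    where st: "stab (pw(w := xs)) wife husband" and h: "husband w = Some m"
    by (auto simp: stable_husbands_def)
  have st': "stab ?p wife husband"
    using st h unfolding stable_matching_def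
    by (auto split: if_splits simp: prefers_def)
  have "husband_of ?p w \<noteq> None" using stable_matched_woman[OF st'] h by simp
  then obtain m' where "prop ?p m' w" "\<not> rej ?p m' w" by (auto simp: husband_of_iff)
  moreover have "m' = m" using calculation unacceptable[of M pm ?p m' w] by auto
  \<comment> \<open>A proposer other than \<open>m\<close> strictly prefers \<open>w\<close> to his
    partner, so ranking \<open>m'\<close> above \<open>m\<close> would make a blocking pair.\<close>
  moreover have "prefers xs (Some m) (Some m')"
    if m': "m' \<in> set xs" "prop ?p m' w" "m' \<noteq> m" for m'
  proof -
    have "wife m' \<noteq> Some w" using st h m'(3) unfolding stable_matching_def matching_def by auto
    then have "prefers (pm m') (Some w) (wife m')"
      using stable_proposes_rejected(1)[OF st' m'(2)] propD(2)[OF m'(2)]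
        prefers_linear[of w "pm m'" "wife m'"] by blast
    then have "\<not> prefers xs (Some m') (Some m)"
      using st propD[OF m'(2)] h unfolding stable_matching_def by (metis fun_upd_same)
    then show ?thesis using prefers_linear[of m' xs "Some m"] m'(1,3) by auto
  qed
  ultimately show ?R by blast
next
  let ?p = "pw(w := [m])"
  assume R: ?R
  have "\<not> rej ?p m w" by (auto elim!: rejected.cases simp: prefers_def)
  then have h: "husband_of ?p w = Some m" using R by (simp add: husband_of_iff)
  have st: "stab ?p (wife_of ?p) (husband_of ?p)" by (rule deferred_acceptance_stable)
  \<comment> \<open>A man who would rather have \<open>w\<close> than his wife has proposed to
    \<open>w\<close> and been rejected, and \<open>?R\<close> ranks \<open>m\<close> above every
    other acceptable proposer.\<close>
  have "\<not> prefers xs (Some m') (Some m)" if "m' \<in> M" "prefers (pm m') (Some w) (wife_of ?p m')" for m'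
  proof -
    have "prop ?p m' w" using prefers_wife_of_imp_rejected[OF that] by (rule rejected_imp_proposes)
    then show ?thesis using R prefers_imp_in_set[of xs m'] prefers_asym prefers_irrefl by metis
  qed
  then have "stab (pw(w := xs)) (wife_of ?p) (husband_of ?p)"
    using st h assms(2) unfolding stable_matching_def by (auto split: if_splits)
  then show "m \<in> stable_husbands M W pm (pw(w := xs)) w" using h by (auto simp: stable_husbands_def)
qed

lemma proposes_subset_reject_all:
  "prop (pw(w := xs)) m u \<Longrightarrow> prop (pw(w := [])) m u"
  by (rule proposes_rejected_mono(1)[of M pm pw w xs "[]"]) (auto intro: unacceptable)

text \<open>The list \<open>[m']\<close> rejects every proposer but \<open>m'\<close>, so
  monotonicity could fail only through \<open>m'\<close> himself. Taking \<open>xs = [m]\<close>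
  will give the nesting of the proposer sets.\<close>

lemma proposes_subset_accept_only:
  assumes "\<not> (prop (pw(w := xs)) m' w \<and> prop (pw(w := [m'])) m' w)"
  shows "prop (pw(w := xs)) m u \<Longrightarrow> prop (pw(w := [m'])) m u"
  using assms rejected_imp_proposes[of M pm]
  by (intro proposes_rejected_mono(1)[of M pm pw w xs "[m']"]) (auto intro!: unacceptable)

end

subsection \<open>Favourites and successive draws\<close>

definition top_of :: "'a list \<Rightarrow> 'a set \<Rightarrow> 'a \<Rightarrow> bool" where
  "top_of xs C y \<longleftrightarrow> y \<in> C \<and> (\<forall>z\<in>C - {y}. prefers xs (Some y) (Some z))"

lemma top_of_unique: "top_of xs C y \<Longrightarrow> top_of xs C z \<Longrightarrow> y = z"
  unfolding top_of_def using prefers_asym by fastforce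

lemma prefers_filter:
  "a \<in> B \<Longrightarrow> b \<in> B \<Longrightarrow>
    prefers (filter (\<lambda>x. x \<in> B) xs) (Some a) (Some b) \<longleftrightarrow> prefers xs (Some a) (Some b)"
  by (induction xs) (auto simp: prefers_Cons)

lemma top_of_filter: "C \<subseteq> B \<Longrightarrow> top_of (filter (\<lambda>x. x \<in> B) xs) C y \<longleftrightarrow> top_of xs C y"
  unfolding top_of_def using prefers_filter[of y B _ xs] by blast

lemma top_of_Cons:
  "y \<in> C \<Longrightarrow> top_of (x # xs) C y \<longleftrightarrow> x = y \<or> x \<notin> C \<and> top_of xs C y"
  by (auto simp: top_of_def prefers_Cons)

lemma ex_top_of:
  assumes "finite C" "C \<subseteq> set xs" "C \<noteq> {}"
  shows "\<exists>y. top_of xs C y"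
proof -
  from assms obtain x where "x \<in> C" "x \<in> set xs" by auto
  then show ?thesis using finite_rank_minimal[OF assms(1)] unfolding top_of_def by (metis Diff_iff insertCI)
qed

lemma most_preferred_eqI: "top_of xs S m \<Longrightarrow> most_preferred xs S = m"
  unfolding most_preferred_def top_of_def
  by (rule the_equality) (blast, metis DiffI empty_iff insert_iff prefers_asym)

lemma least_preferred_eqI:
  "m \<in> S \<Longrightarrow> (\<And>m'. m' \<in> S \<Longrightarrow> m' \<noteq> m \<Longrightarrow> prefers xs (Some m') (Some m)) \<Longrightarrow> least_preferred xs S = m"
  unfolding least_preferred_def
  by (rule the_equality) (blast, metis DiffI empty_iff insert_iff prefers_asym)

text \<open>Drawing exactly \<open>card R\<close> times ranks all of \<open>R\<close> and lets
  inductions run on \<open>R\<close> alone.\<close>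

definition draws :: "'a pmf \<Rightarrow> 'a set \<Rightarrow> 'a list pmf" where
  "draws D R = draw_without_replacement D (card R) R"

lemma draws_empty [simp]: "draws D {} = return_pmf []"
  by (simp add: draws_def)

lemma cond_pmf_support:
  assumes "R \<subseteq> set_pmf D" "R \<noteq> {}"
  shows "set_pmf (cond_pmf D R) = R"
  using assms by (subst set_cond_pmf) auto

lemma pmf_cond_support:
  assumes "R \<subseteq> set_pmf D" "R \<noteq> {}" "x \<in> R"
  shows "pmf (cond_pmf D R) x = pmf D x / measure_pmf.prob D R"
  using assms by (subst pmf_cond) auto

lemma draws_step:
  assumes "finite R" "R \<subseteq> set_pmf D" "R \<noteq> {}"
  shows "draws D R = cond_pmf D R \<bind> (\<lambda>x. map_pmf ((#) x) (draws D (R - {x})))"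
proof -
  obtain n where "card R = Suc n" using assms by (metis card_eq_0_iff not0_implies_Suc)
  then show ?thesis
    using assms by (simp add: draws_def cond_pmf_support cong: bind_pmf_cong_simp)
qed

lemma set_draws:
  assumes "finite R" "R \<subseteq> set_pmf D" "xs \<in> set_pmf (draws D R)"
  shows "set xs = R"
  using assms
proof (induction R arbitrary: xs rule: finite_remove_induct)
  case (remove R)
  then obtain x ys where "x \<in> R" "xs = x # ys" "ys \<in> set_pmf (draws D (R - {x}))"
    by (auto simp: draws_step cond_pmf_support)
  then show ?case using remove(4)[of x ys] remove(5) by auto
qed auto

lemma finite_draws:
  assumes "finite R" "R \<subseteq> set_pmf D"
  shows "finite (set_pmf (draws D R))"
  using assms
proof (induction R rule: finite_remove_induct)
  case (remove R)
  have "finite (set_pmf (draws D (R - {x})))" if "x \<in> R" for x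
    using remove(4)[OF that] remove(5) by blast
  then show ?case using remove by (auto simp: draws_step cond_pmf_support)
qed auto

lemma expectation_draws_step:
  fixes h :: "'a list \<Rightarrow> real"
  assumes "finite R" "R \<subseteq> set_pmf D" "R \<noteq> {}"
  shows "measure_pmf.expectation (draws D R) h =
    (\<Sum>x\<in>R. pmf D x / measure_pmf.prob D R * measure_pmf.expectation (draws D (R - {x})) (\<lambda>xs. h (x # xs)))"
proof -
  have fin: "finite (set_pmf (draws D (R - {x})))" for x
    using assms by (intro finite_draws) auto
  have "measure_pmf.expectation (draws D R) h =
      (\<Sum>x\<in>R. pmf (cond_pmf D R) x *\<^sub>R
        measure_pmf.expectation (map_pmf ((#) x) (draws D (R - {x}))) h)"
    unfolding draws_step[OF assms]
    using assms fin by (intro pmf_expectation_bind) (auto simp: cond_pmf_support)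
  also have "\<dots> = (\<Sum>x\<in>R. pmf D x / measure_pmf.prob D R *
      measure_pmf.expectation (draws D (R - {x})) (\<lambda>xs. h (x # xs)))"
    using assms by (intro sum.cong) (auto simp: pmf_cond_support)
  finally show ?thesis .
qed

lemma prob_pos:
  assumes "R \<subseteq> set_pmf D" "R \<noteq> {}"
  shows "measure_pmf.prob D R > 0"
  using assms by (intro measure_pmf_posI[of "SOME x. x \<in> R"]) (auto intro: someI_ex some_in_eq[THEN iffD2])

lemma sum_pmf_div:
  assumes "finite R"
  shows "(\<Sum>x\<in>R. pmf D x / c * b) = measure_pmf.prob D R / c * b"
  using assms by (simp add: measure_measure_pmf_finite sum_distrib_right sum_divide_distrib)

text \<open>Condition on the first draw: outside \<open>B\<close> it leaves the filtered list
  untouched, inside \<open>B\<close> it acts as a first draw from \<open>B\<close> with the right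
  proportions, and the weights of the two cases sum to 1.\<close>

lemma expectation_draws_filter:
  fixes h :: "'a list \<Rightarrow> real"
  assumes "finite R" "R \<subseteq> set_pmf D" "B \<subseteq> R"
  shows "measure_pmf.expectation (draws D R) (\<lambda>xs. h (filter (\<lambda>x. x \<in> B) xs)) =
    measure_pmf.expectation (draws D B) h"
  using assms
proof (induction R arbitrary: B h rule: finite_remove_induct)
  case (remove R)
  let ?f = "\<lambda>B xs. filter (\<lambda>x. x \<in> B) xs" and ?P = "measure_pmf.prob D" and ?E = "measure_pmf.expectation"
  have pos: "?P R > 0" using remove prob_pos by blast
  have finB: "finite B" using remove finite_subset by blast
  have 1: "?E (draws D (R - {x})) (\<lambda>xs. h (?f B (x # xs))) = ?E (draws D (B - {x})) (\<lambda>xs. h (x # xs))"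
    if "x \<in> B" for x
  proof -
    have "set xs = R - {x}" if "xs \<in> set_pmf (draws D (R - {x}))" for xs
      using set_draws[OF _ _ that] remove by blast
    then have "?f B xs = ?f (B - {x}) xs" if "xs \<in> set_pmf (draws D (R - {x}))" for xs
      using that by (intro filter_cong) auto
    then have "?E (draws D (R - {x})) (\<lambda>xs. h (?f B (x # xs)))
        = ?E (draws D (R - {x})) (\<lambda>xs. h (x # ?f (B - {x}) xs))"
      using that by (intro integral_cong_AE) (auto simp: AE_measure_pmf_iff)
    also have "\<dots> = ?E (draws D (B - {x})) (\<lambda>xs. h (x # xs))"
      using that remove.prems by (intro remove.IH[of x "B - {x}" "\<lambda>xs. h (x # xs)"]) auto
    finally show ?thesis .
  qed
  have 2: "?E (draws D (R - {x})) (\<lambda>xs. h (?f B (x # xs))) = ?E (draws D B) h" if "x \<in> R - B" for x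
    using that remove.prems remove.IH[of x B h] by auto
  have "?E (draws D R) (\<lambda>xs. h (?f B xs)) =
      (\<Sum>x\<in>B. pmf D x / ?P R * ?E (draws D (B - {x})) (\<lambda>xs. h (x # xs)))
      + (\<Sum>x\<in>R - B. pmf D x / ?P R * ?E (draws D B) h)"
    using remove.prems
    by (simp only: expectation_draws_step[OF remove.hyps(1) remove.prems(1) remove.hyps(2)]
        sum.subset_diff[OF remove.prems(2) remove.hyps(1)] 1 2 add.commute cong: sum.cong)
  also have "(\<Sum>x\<in>B. pmf D x / ?P R * ?E (draws D (B - {x})) (\<lambda>xs. h (x # xs)))
      = ?P B / ?P R * ?E (draws D B) h"
  proof (cases "B = {}")
    case False
    then have "?P B > 0" using remove.prems prob_pos[of B D] by blast
    then show ?thesis using False finB remove.prems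
      by (subst expectation_draws_step) (auto simp: sum_distrib_left intro!: sum.cong)
  qed simp
  also have "(\<Sum>x\<in>R - B. pmf D x / ?P R * ?E (draws D B) h) = (?P R - ?P B) / ?P R * ?E (draws D B) h"
    using remove.hyps remove.prems
    by (simp only: sum_pmf_div finite_Diff) (simp add: measure_pmf.finite_measure_Diff)
  also have "?P B / ?P R * ?E (draws D B) h + (?P R - ?P B) / ?P R * ?E (draws D B) h = ?E (draws D B) h"
    using pos by (simp add: field_simps)
  finally show ?case .
qed (simp add: subset_empty)

text \<open>Luce's choice axiom, with independence: which element of \<open>C\<close> comes first, if it lies outside
  \<open>B\<close>, says nothing about the relative order within \<open>B\<close>.\<close>

lemma expectation_top_of_filter:
  fixes h :: "'a list \<Rightarrow> real"
  assumes "finite R" "R \<subseteq> set_pmf D" "C \<subseteq> R" "B \<subseteq> C" "y \<in> C - B"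
  shows "measure_pmf.expectation (draws D R) (\<lambda>xs. of_bool (top_of xs C y) * h (filter (\<lambda>x. x \<in> B) xs)) =
    pmf D y / measure_pmf.prob D C * measure_pmf.expectation (draws D B) h"
  using assms
proof (induction R rule: finite_remove_induct)
  case (remove R)
  let ?f = "\<lambda>xs. filter (\<lambda>x. x \<in> B) xs" and ?P = "measure_pmf.prob D" and ?E = "measure_pmf.expectation"
  let ?g = "\<lambda>xs. of_bool (top_of xs C y) * h (?f xs)"
  let ?e = "?E (draws D B) h"
  have pos: "?P R > 0" "?P C > 0" using remove prob_pos[of R D] prob_pos[of C D] by blast+
  have finC: "finite C" using remove finite_subset by blast
  \<comment> \<open>A first draw in \<open>C\<close> settles the event; if it is \<open>y\<close>,
    which lies outside \<open>B\<close>, the order on \<open>B\<close> is still entirely to be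
    drawn.\<close>
  have 1: "?E (draws D (R - {x})) (\<lambda>xs. ?g (x # xs)) = (if x = y then ?e else 0)"
    if "x \<in> C" for x
  proof (cases "x = y")
    case True
    then have "?E (draws D (R - {x})) (\<lambda>xs. ?g (x # xs)) = ?E (draws D (R - {x})) (\<lambda>xs. h (?f xs))"
      using remove.prems by (auto simp: top_of_Cons)
    also have "\<dots> = ?e"
      using remove.hyps remove.prems True by (intro expectation_draws_filter) auto
    finally show ?thesis using True by simp
  qed (use that remove.prems in \<open>auto simp: top_of_Cons\<close>)
  have 2: "?E (draws D (R - {x})) (\<lambda>xs. ?g (x # xs)) = pmf D y / ?P C * ?e" if x: "x \<in> R - C" for x
  proof -
    have "?E (draws D (R - {x})) (\<lambda>xs. ?g (x # xs)) = ?E (draws D (R - {x})) ?g"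
      using remove.prems x by (intro Bochner_Integration.integral_cong) (auto simp: top_of_Cons)
    then show ?thesis using remove.IH[of x] x remove.prems by auto
  qed
  have "?E (draws D R) ?g = (\<Sum>x\<in>C. pmf D x / ?P R * (if x = y then ?e else 0))
      + (\<Sum>x\<in>R - C. pmf D x / ?P R * (pmf D y / ?P C * ?e))"
    using remove.prems
    by (simp only: expectation_draws_step[OF remove.hyps(1) remove.prems(1) remove.hyps(2)]
        sum.subset_diff[OF remove.prems(2) remove.hyps(1)] 1 2 add.commute cong: sum.cong)
  also have "\<dots> = pmf D y / ?P R * ?e + (?P R - ?P C) / ?P R * (pmf D y / ?P C * ?e)"
    using remove.hyps remove.prems finC by (simp only: sum_pmf_div finite_Diff)
      (auto simp: measure_pmf.finite_measure_Diff if_distrib cong: if_cong)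
  also have "\<dots> = pmf D y / ?P C * ?e"
    using pos by (simp add: field_simps)
  finally show ?case .
qed auto

lemma prob_top_of:
  assumes "finite R" "R \<subseteq> set_pmf D" "C \<subseteq> R" "y \<in> C"
  shows "measure_pmf.expectation (draws D R) (\<lambda>xs. of_bool (top_of xs C y)) = pmf D y / measure_pmf.prob D C"
  using expectation_top_of_filter[of R D C "{}" y "\<lambda>_. 1"] assms by simp

subsection \<open>Logarithmic bounds\<close>

text \<open>Gibbs' inequality against the uniform distribution on \<open>C\<close>, from ln t \<le>
  t - 1.\<close>

lemma entropy_le:
  assumes "finite C" "C \<subseteq> set_pmf D" "C \<noteq> {}"
  shows "(\<Sum>y\<in>C. pmf D y / measure_pmf.prob D C * ln (measure_pmf.prob D C / pmf D y)) \<le> ln (real (card C))"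
proof -
  let ?P = "measure_pmf.prob D C" and ?n = "real (card C)"
  have P: "?P > 0" and n: "?n > 0" using assms prob_pos[of C D] by (auto simp: card_gt_0_iff)
  have P_eq: "(\<Sum>y\<in>C. pmf D y) = ?P" using assms by (simp add: measure_measure_pmf_finite)
  have "pmf D y / ?P * (ln (?P / pmf D y) - ln ?n) \<le> 1 / ?n - pmf D y / ?P" if "y \<in> C" for y
  proof -
    have y: "pmf D y > 0" using that assms by (auto simp: pmf_positive)
    have "ln (?P / pmf D y) - ln ?n = ln (?P / pmf D y / ?n)" using P n y by (simp add: ln_div ln_mult)
    also have "\<dots> \<le> ?P / pmf D y / ?n - 1" using P n y by (intro ln_le_minus_one) auto
    finally have "pmf D y / ?P * (ln (?P / pmf D y) - ln ?n) \<le> pmf D y / ?P * (?P / pmf D y / ?n - 1)"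
      using P y by (intro mult_left_mono) auto
    also have "\<dots> = 1 / ?n - pmf D y / ?P" using P n y by (simp add: field_simps)
    finally show ?thesis .
  qed
  then have "(\<Sum>y\<in>C. pmf D y / ?P * (ln (?P / pmf D y) - ln ?n)) \<le> (\<Sum>y\<in>C. 1 / ?n - pmf D y / ?P)"
    by (rule sum_mono)
  also have "\<dots> = 0" using P n by (simp add: sum_subtractf P_eq flip: sum_divide_distrib)
  finally have "(\<Sum>y\<in>C. pmf D y / ?P * ln (?P / pmf D y)) \<le> (\<Sum>y\<in>C. pmf D y / ?P * ln ?n)"
    by (simp add: right_diff_distrib sum_subtractf)
  also have "\<dots> = ln ?n" using P by (simp add: P_eq flip: sum_distrib_right sum_divide_distrib)
  finally show ?thesis .
qed

text \<open>The sum is bounded by telescoping along any enumeration of \<open>Y\<close> by increasing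
  cardinality of \<open>\<kappa>\<close>.\<close>

lemma sum_ratio_le_ln:
  assumes "finite Y" "B \<noteq> {}" "B \<subseteq> set_pmf D" "Y \<subseteq> set_pmf D" "B \<inter> Y = {}"
    and "\<And>y. y \<in> Y \<Longrightarrow> finite (\<kappa> y)"
    and "\<And>y. y \<in> Y \<Longrightarrow> B \<subseteq> \<kappa> y"
    and "\<And>y. y \<in> Y \<Longrightarrow> y \<in> \<kappa> y"
    and "\<And>y z. y \<in> Y \<Longrightarrow> z \<in> Y \<Longrightarrow> z \<notin> \<kappa> y \<Longrightarrow> \<kappa> y \<subseteq> \<kappa> z"
  shows "(\<Sum>y\<in>Y. pmf D y / measure_pmf.prob D (\<kappa> y))
    \<le> ln (measure_pmf.prob D (B \<union> Y)) - ln (measure_pmf.prob D B)"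
  using assms
proof (induction Y rule: finite_psubset_induct)
  case (psubset Y)
  let ?P = "measure_pmf.prob D"
  show ?case
  proof (cases "Y = {}")
    case False
    then obtain y where y: "y \<in> Y" "\<And>z. z \<in> Y \<Longrightarrow> card (\<kappa> z) \<le> card (\<kappa> y)"
      using obtains_MAX[OF psubset.hyps, of "\<lambda>y. card (\<kappa> y)"] psubset.hyps
      by (metis Max_ge finite_imageI imageI)
    \<comment> \<open>An omitted \<open>z\<close> would make \<open>\<kappa> z\<close> a strict
      superset of \<open>\<kappa> y\<close>, against the maximal cardinality of
      \<open>\<kappa> y\<close>.\<close>
    have "z \<in> \<kappa> y" if "z \<in> Y" for z
    proof (rule ccontr)
      assume "z \<notin> \<kappa> y"
      then have "\<kappa> y \<subset> \<kappa> z" using psubset.prems y(1) that by blast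
      then have "card (\<kappa> y) < card (\<kappa> z)"
        by (rule psubset_card_mono[OF psubset.prems(5)[OF that]])
      then show False using y(2)[OF that] by simp
    qed
    then have sub: "B \<union> Y \<subseteq> \<kappa> y" using psubset.prems y(1) by blast
    have y_pos: "pmf D y > 0" using psubset.prems y(1) by (auto simp: pmf_positive)
    have BY: "?P (B \<union> Y) = pmf D y + ?P (B \<union> (Y - {y}))"
    proof -
      have "B \<union> Y = {y} \<union> (B \<union> (Y - {y}))" "{y} \<inter> (B \<union> (Y - {y})) = {}"
        using y(1) psubset.prems by auto
      then show ?thesis
        using measure_pmf.finite_measure_Union[of "{y}" D "B \<union> (Y - {y})"] by (simp add: measure_pmf_single)
    qed
    have pos: "?P (B \<union> (Y - {y})) > 0" "?P (B \<union> Y) > 0"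
      using psubset.prems(1-3) by (auto intro!: prob_pos)
    have "(\<Sum>z\<in>Y - {y}. pmf D z / ?P (\<kappa> z)) \<le> ln (?P (B \<union> (Y - {y}))) - ln (?P B)"
      using y(1) psubset.prems by (intro psubset.IH) auto
    moreover have "pmf D y / ?P (\<kappa> y) \<le> pmf D y / ?P (B \<union> Y)"
      using pos(2) measure_pmf.finite_measure_mono[OF sub, of D] by (intro divide_left_mono) auto
    \<comment> \<open>With S the mass of \<open>B \<union> Y\<close>, this is ln (1 - D y / S) \<le>
      - D y / S, so the term of \<open>y\<close> is at most ln S - ln (S - D y).\<close>
    moreover have "ln (?P (B \<union> (Y - {y})) / ?P (B \<union> Y)) \<le> ?P (B \<union> (Y - {y})) / ?P (B \<union> Y) - 1"
      using pos by (intro ln_le_minus_one) auto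
    moreover have "?P (B \<union> (Y - {y})) / ?P (B \<union> Y) - 1 = - (pmf D y / ?P (B \<union> Y))"
      using pos by (simp add: BY field_simps)
    ultimately show ?thesis
      using pos by (simp add: sum.remove[OF psubset.hyps y(1)] ln_div)
  qed simp
qed

subsection \<open>Counting the stable husbands\<close>

text \<open>Below, \<open>K\<close> will be the acceptable men proposing to the woman when she rejects everybody and
  \<open>\<kappa> m\<close> those proposing when she accepts only \<open>m\<close>; then \<open>local_tops\<close> are her stable husbands and
  \<open>lowest_at\<close> singles out the least preferred one by a condition on the order of \<open>\<kappa> m\<close> alone.\<close>

definition lowest_at :: "'a set \<Rightarrow> ('a \<Rightarrow> 'a set) \<Rightarrow> 'a list \<Rightarrow> 'a \<Rightarrow> bool" where
  "lowest_at K \<kappa> xs m \<longleftrightarrow> m \<in> K \<and> top_of xs (\<kappa> m) m \<and>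
     (\<forall>m'\<in>\<kappa> m. m \<notin> \<kappa> m' \<longrightarrow> \<not> top_of xs (\<kappa> m') m')"

definition local_tops :: "'a set \<Rightarrow> ('a \<Rightarrow> 'a set) \<Rightarrow> 'a list \<Rightarrow> 'a set" where
  "local_tops K \<kappa> xs = {m \<in> K. top_of xs (\<kappa> m) m}"

locale proposer_sets =
  fixes D :: "'a pmf" and K :: "'a set" and \<kappa> :: "'a \<Rightarrow> 'a set"
  assumes finite_support: "finite (set_pmf D)"
    and K_support: "K \<subseteq> set_pmf D" and K_nonempty: "K \<noteq> {}"
    and self: "m \<in> K \<Longrightarrow> m \<in> \<kappa> m" and \<kappa>_K: "m \<in> K \<Longrightarrow> \<kappa> m \<subseteq> K"
    and absent: "m \<in> K \<Longrightarrow> m' \<in> K \<Longrightarrow> m' \<notin> \<kappa> m \<Longrightarrow> \<kappa> m \<subseteq> \<kappa> m'"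
begin

abbreviation "G \<equiv> local_tops K \<kappa>"
abbreviation "L \<equiv> lowest_at K \<kappa>"
abbreviation "p \<equiv> draws D (set_pmf D)"

lemma finite_K: "finite K"
  using finite_subset[OF K_support finite_support] .

text \<open>Two local tops cannot lie in each other's sets, since each would beat the other; by
  \<open>absent\<close> and \<open>self\<close> at least one of them lies in the set of the other.
  Membership thus determines their order.\<close>

lemma local_tops_comparable:
  assumes "m \<in> G xs" "m' \<in> G xs" "m' \<noteq> m"
  shows "m' \<in> \<kappa> m \<and> m \<notin> \<kappa> m' \<and> prefers xs (Some m) (Some m') \<or>
    m' \<notin> \<kappa> m \<and> m \<in> \<kappa> m' \<and> prefers xs (Some m') (Some m)"
proof (cases "m' \<in> \<kappa> m")
  case True
  then have "prefers xs (Some m) (Some m')" using assms by (auto simp: local_tops_def top_of_def)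
  moreover have "m \<notin> \<kappa> m'"
    using assms prefers_asym[OF calculation] by (auto simp: local_tops_def top_of_def)
  ultimately show ?thesis using True by blast
next
  case False
  then have "m \<in> \<kappa> m'" using assms absent[of m m'] self[of m] by (auto simp: local_tops_def)
  then show ?thesis using False assms by (auto simp: local_tops_def top_of_def)
qed

lemma lowest_prefers:
  assumes "L xs m" "m' \<in> G xs" "m' \<noteq> m"
  shows "m' \<notin> \<kappa> m" "prefers xs (Some m') (Some m)"
proof -
  have "m \<in> G xs" using assms by (auto simp: lowest_at_def local_tops_def)
  from local_tops_comparable[OF this assms(2,3)]
  show "m' \<notin> \<kappa> m" "prefers xs (Some m') (Some m)"
    using assms by (auto simp: lowest_at_def local_tops_def)
qed

lemma least_preferred_lowest:
  assumes "L xs m"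
  shows "least_preferred xs (G xs) = m"
  using assms lowest_prefers[OF assms]
  by (intro least_preferred_eqI) (auto simp: lowest_at_def local_tops_def)

lemma top_of_K_local:
  assumes "top_of xs K y"
  shows "top_of xs (G xs) y"
  using assms self \<kappa>_K unfolding top_of_def local_tops_def by blast

lemma ex_lowest:
  assumes "set xs = set_pmf D"
  shows "\<exists>m. L xs m"
proof -
  obtain b where "top_of xs K b"
    using ex_top_of[of K xs] finite_K K_support K_nonempty assms by blast
  then have "b \<in> G xs" using top_of_K_local[of xs b] by (simp add: top_of_def)
  then have "G xs \<noteq> {}" by blast
  moreover have "finite (G xs)" using finite_K by (simp add: local_tops_def)
  \<comment> \<open>The local top of largest rank: another local top \<open>m'\<close> in
    \<open>\<kappa> m\<close> with \<open>m\<close> outside \<open>\<kappa> m'\<close> would rank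
    even lower.\<close>
  ultimately obtain m where m: "m \<in> G xs"
      "\<And>m'. m' \<in> G xs \<Longrightarrow> pref_rank xs (Some m') \<le> pref_rank xs (Some m)"
    using obtains_MAX[of "G xs" "\<lambda>m. pref_rank xs (Some m)"] by (metis Max_ge finite_imageI imageI)
  have "\<not> top_of xs (\<kappa> m') m'" if m': "m' \<in> \<kappa> m" "m \<notin> \<kappa> m'" for m'
  proof
    assume "top_of xs (\<kappa> m') m'"
    then have "m' \<in> G xs" using m(1) m'(1) \<kappa>_K by (auto simp: local_tops_def)
    moreover have "m' \<noteq> m" using m' m(1) self by (auto simp: local_tops_def)
    ultimately have "prefers xs (Some m) (Some m')"
      using local_tops_comparable[OF m(1)] m' by blast
    then show False using m(2)[OF \<open>m' \<in> G xs\<close>] by (simp add: prefers_def)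
  qed
  then show ?thesis using m(1) by (auto simp: lowest_at_def local_tops_def)
qed

text \<open>By \<open>absent\<close>, each \<open>\<kappa> m'\<close> omitting \<open>m\<close> that
  occurs in the condition is contained in \<open>\<kappa> m\<close>, so all comparisons stay there.
  This is the form of event that \<open>expectation_top_of_filter\<close> handles.\<close>

lemma lowest_filter: "L (filter (\<lambda>x. x \<in> \<kappa> m) xs) m \<longleftrightarrow> L xs m"
proof (cases "m \<in> K")
  case True
  have "top_of (filter (\<lambda>x. x \<in> \<kappa> m) xs) (\<kappa> m') m' \<longleftrightarrow> top_of xs (\<kappa> m') m'"
    if "m' \<in> \<kappa> m" "m \<notin> \<kappa> m'" for m'
    using absent[of m' m] \<kappa>_K[OF True] True that by (intro top_of_filter) blast
  then show ?thesis by (auto simp: lowest_at_def top_of_filter)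
qed (simp add: lowest_at_def)

lemma card_local_tops_le:
  assumes "L xs m"
  shows "real (card (G xs)) \<le> 1 + (\<Sum>y\<in>K - \<kappa> m. of_bool (top_of xs (\<kappa> y) y))"
proof -
  have "G xs \<subseteq> insert m {y \<in> K - \<kappa> m. top_of xs (\<kappa> y) y}" (is "_ \<subseteq> insert m ?S")
    using lowest_prefers(1)[OF assms] by (auto simp: local_tops_def)
  then have "card (G xs) \<le> card (insert m ?S)"
    using finite_K by (intro card_mono) auto
  also have "\<dots> \<le> Suc (card ?S)" by (rule card_insert_le_m1[THEN order_trans]) auto
  finally show ?thesis
    using finite_K by (simp add: sum.inter_filter[symmetric] of_bool_def Int_def)
qed

lemma sum_lowest:
  fixes f :: "'a \<Rightarrow> real"
  assumes "L xs m"
  shows "(\<Sum>m\<in>K. of_bool (L xs m) * f m) = f m"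
proof -
  have "L xs m' \<longleftrightarrow> m' = m" for m'
    using assms least_preferred_lowest by blast
  moreover have "m \<in> K" using assms by (simp add: lowest_at_def)
  ultimately show ?thesis using finite_K by (simp add: sum_of_bool_mult_eq)
qed

lemma sum_top_of:
  fixes f :: "'a \<Rightarrow> real"
  assumes "top_of xs K b"
  shows "(\<Sum>y\<in>K. of_bool (top_of xs K y) * f y) = f b"
proof -
  have "top_of xs K y \<longleftrightarrow> y = b" for y using assms top_of_unique by metis
  moreover have "b \<in> K" using assms by (simp add: top_of_def)
  ultimately show ?thesis using finite_K by (simp add: sum_of_bool_mult_eq)
qed

lemma expectation_card_local_tops:
  "measure_pmf.expectation p (\<lambda>xs. real (card (G xs))) \<le> 1 + ln (real (card (set_pmf D))) +
    measure_pmf.expectation p (\<lambda>xs. ln (pmf D (most_preferred xs (G xs)) / pmf D (least_preferred xs (G xs))))"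
proof -
  let ?P = "measure_pmf.prob D" and ?E = "measure_pmf.expectation p"
  let ?T = "\<lambda>y xs. of_bool (top_of xs (\<kappa> y) y) :: real"
  define q where "q m = ?E (\<lambda>xs. of_bool (L xs m) :: real)" for m
  have int: "integrable p f" for f :: "'a list \<Rightarrow> real"
    using finite_support by (intro integrable_measure_pmf_finite finite_draws) auto
  have set_xs: "set xs = set_pmf D" if "xs \<in> set_pmf p" for xs
    using that finite_support by (intro set_draws) auto
  have pos: "pmf D y > 0" if "y \<in> K" for y using that K_support by (auto simp: pmf_positive)
  have q_filter: "q m = measure_pmf.expectation (draws D (\<kappa> m)) (\<lambda>xs. of_bool (L xs m))" if "m \<in> K" for m
    unfolding q_def
    using expectation_draws_filter[of "set_pmf D" D "\<kappa> m" "\<lambda>xs. of_bool (L xs m)"]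
      that finite_support subset_trans[OF \<kappa>_K K_support] by (simp add: lowest_filter)
  have "?E (\<lambda>xs. real (card (G xs))) \<le>
      ?E (\<lambda>xs. 1 + (\<Sum>m\<in>K. of_bool (L xs m) * (\<Sum>y\<in>K - \<kappa> m. ?T y xs)))"
  proof (intro integral_mono_AE int, simp only: AE_measure_pmf_iff, intro ballI)
    fix xs assume "xs \<in> set_pmf p"
    then obtain m where "L xs m" using ex_lowest set_xs by blast
    then show "real (card (G xs)) \<le> 1 + (\<Sum>m\<in>K. of_bool (L xs m) * (\<Sum>y\<in>K - \<kappa> m. ?T y xs))"
      using card_local_tops_le by (subst sum_lowest) auto
  qed
  also have "\<dots> = 1 + (\<Sum>m\<in>K. \<Sum>y\<in>K - \<kappa> m. ?E (\<lambda>xs. ?T y xs * of_bool (L xs m)))"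
    by (simp add: int sum_distrib_left mult.commute)
  also have "(\<Sum>m\<in>K. \<Sum>y\<in>K - \<kappa> m. ?E (\<lambda>xs. ?T y xs * of_bool (L xs m)))
      = (\<Sum>m\<in>K. q m * (\<Sum>y\<in>K - \<kappa> m. pmf D y / ?P (\<kappa> y)))"
  proof (intro sum.cong refl, unfold sum_distrib_left, intro sum.cong refl)
    fix m y assume my: "m \<in> K" "y \<in> K - \<kappa> m"
    \<comment> \<open>Luce's axiom with \<open>C = \<kappa> y\<close> and
      \<open>B = \<kappa> m\<close>; here \<open>B\<close> lies in \<open>C\<close> by
      \<open>absent\<close>, as \<open>y\<close> is outside \<open>\<kappa> m\<close>.\<close>
    have "?E (\<lambda>xs. ?T y xs * of_bool (L (filter (\<lambda>x. x \<in> \<kappa> m) xs) m))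
        = pmf D y / ?P (\<kappa> y) * measure_pmf.expectation (draws D (\<kappa> m)) (\<lambda>xs. of_bool (L xs m))"
      using my finite_support K_support \<kappa>_K[of y] self[of y] absent[of m y]
      by (intro expectation_top_of_filter) auto
    then show "?E (\<lambda>xs. ?T y xs * of_bool (L xs m)) = q m * (pmf D y / ?P (\<kappa> y))"
      using my by (simp add: lowest_filter q_filter mult.commute)
  qed
  also have "\<dots> \<le> (\<Sum>m\<in>K. q m * (ln (?P K) - ln (pmf D m)))"
  proof (intro sum_mono mult_left_mono)
    fix m assume m: "m \<in> K"
    have U: "\<kappa> m \<union> (K - \<kappa> m) = K" using \<kappa>_K[OF m] by auto
    have "(\<Sum>y\<in>K - \<kappa> m. pmf D y / ?P (\<kappa> y)) \<le> ln (?P (\<kappa> m \<union> (K - \<kappa> m))) - ln (?P (\<kappa> m))"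
    proof (rule sum_ratio_le_ln)
      show "finite (\<kappa> y)" if "y \<in> K - \<kappa> m" for y
        using that \<kappa>_K[of y] finite_K finite_subset by blast
      show "\<kappa> y \<subseteq> \<kappa> z" if "y \<in> K - \<kappa> m" "z \<in> K - \<kappa> m" "z \<notin> \<kappa> y" for y z
        using that absent[of y z] by blast
      show "\<kappa> m \<subseteq> \<kappa> y" if "y \<in> K - \<kappa> m" for y
        using that absent[of m y] m by blast
    qed (use m self \<kappa>_K K_support finite_K in blast)+
    \<comment> \<open>Shrinking the mass of \<open>\<kappa> m\<close> to that of \<open>m\<close>
      alone produces the denominator of the claimed ratio.\<close>
    moreover have "ln (pmf D m) \<le> ln (?P (\<kappa> m))"
    proof -
      have "pmf D m = ?P {m}" by (simp add: measure_pmf_single)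
      also have "\<dots> \<le> ?P (\<kappa> m)" using self[OF m] by (intro measure_pmf.finite_measure_mono) auto
      finally show ?thesis using pos[OF m] by simp
    qed
    ultimately show "(\<Sum>y\<in>K - \<kappa> m. pmf D y / ?P (\<kappa> y)) \<le> ln (?P K) - ln (pmf D m)"
      unfolding U by linarith
  qed (simp add: q_def)
  also have "(\<Sum>m\<in>K. q m * (ln (?P K) - ln (pmf D m)))
      = ?E (\<lambda>xs. \<Sum>m\<in>K. of_bool (L xs m) * (ln (?P K) - ln (pmf D m)))"
    by (simp add: int q_def)
  also have "\<dots> = ?E (\<lambda>xs. (\<Sum>y\<in>K. of_bool (top_of xs K y) * ln (?P K / pmf D y)) +
      ln (pmf D (most_preferred xs (G xs)) / pmf D (least_preferred xs (G xs))))"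
  proof (intro integral_cong_AE, simp, simp, simp only: AE_measure_pmf_iff, intro ballI)
    fix xs assume "xs \<in> set_pmf p"
    then have xs: "set xs = set_pmf D" by (rule set_xs)
    obtain m where m: "L xs m" using ex_lowest[OF xs] by blast
    \<comment> \<open>The favourite \<open>b\<close> in \<open>K\<close> is the most preferred local
      top; ln (D K / D m) splits at D b into an entropy term and the log ratio of the claim.\<close>
    obtain b where b: "top_of xs K b"
      using ex_top_of[of K xs] finite_K K_support K_nonempty xs by blast
    have "m \<in> K" "b \<in> K" using m b by (auto simp: lowest_at_def top_of_def)
    then have "pmf D m > 0" "pmf D b > 0" "?P K > 0"
      using pos prob_pos[OF K_support K_nonempty] by auto
    then show "(\<Sum>m\<in>K. of_bool (L xs m) * (ln (?P K) - ln (pmf D m))) =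
       (\<Sum>y\<in>K. of_bool (top_of xs K y) * ln (?P K / pmf D y)) +
       ln (pmf D (most_preferred xs (G xs)) / pmf D (least_preferred xs (G xs)))"
      by (simp add: sum_lowest[OF m] sum_top_of[OF b] least_preferred_lowest[OF m]
          most_preferred_eqI[OF top_of_K_local[OF b]] ln_div)
  qed
  also have "\<dots> = (\<Sum>y\<in>K. ?E (\<lambda>xs. of_bool (top_of xs K y)) * ln (?P K / pmf D y)) +
      ?E (\<lambda>xs. ln (pmf D (most_preferred xs (G xs)) / pmf D (least_preferred xs (G xs))))"
    by (simp add: int)
  also have "(\<Sum>y\<in>K. ?E (\<lambda>xs. of_bool (top_of xs K y)) * ln (?P K / pmf D y)) \<le> ln (real (card K))"
    using entropy_le[OF finite_K K_support K_nonempty] finite_support K_support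
    by (simp add: prob_top_of)
  also have "ln (real (card K)) \<le> ln (real (card (set_pmf D)))"
    using card_mono[OF finite_support K_support] card_gt_0_iff[of K] finite_K K_nonempty by simp
  finally show ?thesis by simp
qed

end

section \<open>Stable husbands as local tops of the proposer sets\<close>

theorem theorem3:
  fixes M :: "'m set" and W :: "'w set"
    and pm :: "'m \<Rightarrow> 'w list" and pw :: "'w \<Rightarrow> 'm list"
    and w :: 'w and D :: "'m pmf"
  defines "H \<equiv> (\<lambda>xs. stable_husbands M W pm (pw(w := xs)) w)"
  assumes "finite M" and "finite W" and "w \<in> W"
    and "\<And>m. m \<in> M \<Longrightarrow> preference_list W (pm m)"
    and "\<And>w'. w' \<in> W - {w} \<Longrightarrow> preference_list M (pw w')"
    and "set_pmf D \<subseteq> M"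
    and "\<And>xs. xs \<in> set_pmf (popularity_preferences D) \<Longrightarrow> H xs \<noteq> {}"
  shows "measure_pmf.expectation (popularity_preferences D) (\<lambda>xs. real (card (H xs)))
    \<le> 1 + ln (real (card (set_pmf D)))
      + measure_pmf.expectation (popularity_preferences D)
          (\<lambda>xs. ln (pmf D (most_preferred xs (H xs)) / pmf D (least_preferred xs (H xs))))"
proof -
  interpret market M W pm using assms by unfold_locales auto
  define K where "K = {m \<in> set_pmf D. proposes M pm (pw(w := [])) m w}"
  define \<kappa> where "\<kappa> m = {m' \<in> set_pmf D. proposes M pm (pw(w := [m])) m' w}" for m
  have fin: "finite (set_pmf D)" using assms finite_subset by blast
  have pop: "popularity_preferences D = draws D (set_pmf D)"
    by (simp add: popularity_preferences_def draws_def)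
  \<comment> \<open>If \<open>m\<close> did not propose under \<open>[m]\<close>, monotonicity from
    the empty list would apply and make him propose after all.\<close>
  have self: "m \<in> \<kappa> m" if "m \<in> K" for m
    using that proposes_subset_accept_only[of pw w "[]" m m w] by (auto simp: K_def \<kappa>_def)
  have sub: "\<kappa> m \<subseteq> K" for m
    using proposes_subset_reject_all[of pw w "[m]" _ w] by (auto simp: K_def \<kappa>_def)
  have H: "H xs = local_tops K \<kappa> xs" if "xs \<in> set_pmf (popularity_preferences D)" for xs
  proof -
    have xs: "set xs = set_pmf D" using that fin unfolding pop by (intro set_draws) auto
    have "m \<in> set xs" if "m \<in> H xs" for m
      using that \<open>w \<in> W\<close> unfolding H_def stable_husbands_def stable_matching_def by fastforce
    then have "m \<in> H xs \<longleftrightarrow> m \<in> set xs \<and> top_of xs (\<kappa> m) m" for m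
      using stable_husbands_iff[OF \<open>w \<in> W\<close>, of m xs pw]
      by (auto simp: H_def top_of_def \<kappa>_def xs)
    moreover have "top_of xs (\<kappa> m) m \<Longrightarrow> m \<in> K" for m using sub by (auto simp: top_of_def)
    ultimately show ?thesis by (auto simp: local_tops_def xs K_def)
  qed
  obtain xs where "xs \<in> set_pmf (popularity_preferences D)"
    using set_pmf_not_empty[of "popularity_preferences D"] by blast
  then have "K \<noteq> {}" using H assms(8) by (force simp: local_tops_def)
  interpret proposer_sets D K \<kappa>
  proof
    show "\<kappa> m \<subseteq> \<kappa> m'" if "m \<in> K" "m' \<in> K" "m' \<notin> \<kappa> m" for m m'
      using that proposes_subset_accept_only[of pw w "[m]" m' _ w] by (auto simp: K_def \<kappa>_def)
  qed (use fin self sub \<open>K \<noteq> {}\<close> in \<open>auto simp: K_def\<close>)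
  \<comment> \<open>The extreme partners depend on \<open>xs\<close> as well as on the set, hence
    \<open>f\<close> takes both.\<close>
  have "measure_pmf.expectation (popularity_preferences D) (\<lambda>xs. f xs (H xs)) =
      measure_pmf.expectation p (\<lambda>xs. f xs (G xs))" for f :: "'m list \<Rightarrow> 'm set \<Rightarrow> real"
    unfolding pop using H[unfolded pop]
    by (intro integral_cong_AE) (auto simp: AE_measure_pmf_iff)
  from this[of "\<lambda>_ S. real (card S)"]
    this[of "\<lambda>xs S. ln (pmf D (most_preferred xs S) / pmf D (least_preferred xs S))"]
  show ?thesis using expectation_card_local_tops by simp
qed

end
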